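(* Consider the system of evolution equations for real-valued functions $k(x,t),\ell(x,t)$ $$k_t = a k_x + 2k a_x + h\ell_x + \tfrac32 \ell h_x - a_{xxx},$$ $$\ell_t = a\ell_x + 3a_x\ell + \tfrac13 h k_{xxx} + \tfrac32 h_x k_{xx} + \tfrac52 h_{xx}k_x - \tfrac83 h k k_x - \tfrac83 h_x k^2 + \tfrac53 h_{xxx}k - \tfrac16 h^{(5)},$$ which is the system satisfied by the invariants $k,\ell$ of an L-curve in $S^3$ whose normalized framing $(\Gamma,T,N)$ evolves with $$\Gamma_t = \left(-a_x+\tfrac13 i(kh-\tfrac12 h_{xx})\right)\Gamma + (a+\tfrac12 i h_x)T + hN .$$ For every integer $n\ge 0$, under the change of variables $u=-k$, $v=\ell$, choosing $$\begin{bmatrix} a\\ -\tfrac12 h\end{bmatrix} = G_n[u,v]$$ makes this system agree with the $n$th flow of the Boussinesq hierarchy, i.e. $\begin{bmatrix}u\\ v\end{bmatrix}_t = F_n[u,v]$.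
   Context: Geometric setting. On $\mathbb{C}^3$ let $\langle \mathbf z,\mathbf w\rangle = -z_0\overline{w_0}+z_1\overline{w_1}+z_2\overline{w_2}$, let $\mathcal N$ be the cone of nonzero null vectors, $\pi:\mathbb{C}^3\setminus\{0\}\to\mathbb{C}P^2$ the projectivization, and identify $S^3$ with $\pi(\mathcal N)$. An L-curve is a regular parametrized curve $\gamma:I\to S^3$ having a lift $\Gamma:I\to\mathcal N$ with $\langle\Gamma_x,\Gamma\rangle=0$. A null frame is a triple $(e_0,e_1,e_2)$ of vectors in $\mathbb C^3$ with $\langle e_0,e_0\rangle=\langle e_0,e_1\rangle=\langle e_2,e_1\rangle=\langle e_2,e_2\rangle=0$, $\langle e_2,e_0\rangle=i$, $\langle e_0,e_2\rangle=-i$, $\langle e_1,e_1\rangle=1$, $\det(e_0,e_1,e_2)=1$. A normalized framing of an L-curve $\gamma$ is a null frame field $(\Gamma,T,N)$ along $\gamma$ with $\pi\circ\Gamma=\gamma$ and $\Gamma_x=T$, $T_x=iN+k\Gamma$, $N_x=\ell\Gamma-ikT$ for real-valued functions $k,\ell$ (the invariants of the curve). Boussinesq hierarchy. $D=d/dx$ is the total $x$-derivative; adjacent operators are composed, and $\mathcal O\circ f$ is the composition of $\mathcal O$ with multiplication by $f$. Let $$\mathcal Q=\begin{pmatrix}0&D\\ D&0\end{pmatrix},\qquad \mathcal P=\begin{pmatrix} D^3+2uD+u_x & 3vD+2v_x\\ 3vD+v_x & \tfrac13D^5+\tfrac53(uD^3+D^3\circ u)-(u_{xx}D+D\circ u_{xx})+\tfrac{16}{3}uD\circ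 u\end{pmatrix}.$$ Define $G_0=\begin{bmatrix}1\\ 0\end{bmatrix}$, $G_1=\begin{bmatrix}0\\ \tfrac12\end{bmatrix}$, $G_{n+2}=\mathcal Q^{-1}\mathcal P G_n$, and $F_n=\mathcal P G_n$. Equivalently $F_0=\begin{bmatrix}u_x\\ v_x\end{bmatrix}$, $F_1=\begin{bmatrix}v_x\\ \tfrac13u_{xxx}+\tfrac83uu_x\end{bmatrix}$ and $F_{n+2}=\mathcal P\mathcal Q^{-1}F_n$. Here $\mathcal Q^{-1}$ is applied by taking antiderivatives $D^{-1}$ within differential polynomials in $u,v$ with no constant term (it is known that the hierarchy is local, so the $G_n$ and $F_n$ are differential polynomials). The $n$th flow of the Boussinesq hierarchy is $\begin{bmatrix}u\\ v\end{bmatrix}_t=F_n[u,v]$. *)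

theory Defs
  imports "HOL-Analysis.Analysis" "HOL-Library.Poly_Mapping"
begin

definition d_x :: "(real \<Rightarrow> real \<Rightarrow> 'a::real_normed_vector) \<Rightarrow> real \<Rightarrow> real \<Rightarrow> 'a" where
  "d_x f = (\<lambda>x t. vector_derivative (\<lambda>y. f y t) (at x))"

definition d_t :: "(real \<Rightarrow> real \<Rightarrow> 'a::real_normed_vector) \<Rightarrow> real \<Rightarrow> real \<Rightarrow> 'a" where
  "d_t f = (\<lambda>x t. vector_derivative (\<lambda>s. f x s) (at t))"

(* For open S: f is n times continuously differentiable on S, jointly in both variables. *)
fun C_n_on :: "nat \<Rightarrow> (real \<times> real) set \<Rightarrow> (real \<Rightarrow> real \<Rightarrow> 'a::real_normed_vector) \<Rightarrow> bool" where
  "C_n_on 0 S f \<longleftrightarrow> continuous_on S (\<lambda>(x, t). f x t)"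
| "C_n_on (Suc n) S f \<longleftrightarrow>
     (\<forall>p\<in>S. (\<lambda>(x, t). f x t) differentiable (at p)) \<and> C_n_on n S (d_x f) \<and> C_n_on n S (d_t f)"

definition smooth_on :: "(real \<times> real) set \<Rightarrow> (real \<Rightarrow> real \<Rightarrow> 'a::real_normed_vector) \<Rightarrow> bool" where
  "smooth_on S f \<longleftrightarrow> (\<forall>n. C_n_on n S f)"

(* The coordinates z_0, z_1, z_2 are z $ 1, z $ 2, z $ 3. *)
definition herm :: "complex ^ 3 \<Rightarrow> complex ^ 3 \<Rightarrow> complex" where
  "herm z w = - (z $ 1) * cnj (w $ 1) + z $ 2 * cnj (w $ 2) + z $ 3 * cnj (w $ 3)"

definition null_cone :: "(complex ^ 3) set" where
  "null_cone = {z. z \<noteq> 0 \<and> herm z z = 0}"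

(* The point of the complex projective plane represented by z \<noteq> 0 is encoded as
   the punctured complex line through z. *)
definition proj :: "complex ^ 3 \<Rightarrow> (complex ^ 3) set" where
  "proj z = {c *s z | c. c \<noteq> 0}"

definition sphere3 :: "(complex ^ 3) set set" where
  "sphere3 = proj ` null_cone"

definition vec_deriv :: "(real \<Rightarrow> complex ^ 3) \<Rightarrow> real \<Rightarrow> complex ^ 3" where
  "vec_deriv f = (\<lambda>x. vector_derivative f (at x))"

definition smooth_curve :: "real set \<Rightarrow> (real \<Rightarrow> complex ^ 3) \<Rightarrow> bool" where
  "smooth_curve I f \<longleftrightarrow> (\<forall>n. \<forall>x\<in>I. (vec_deriv ^^ n) f differentiable (at x))"

(* The kernel of the differential of the projection at z is the complex line through z, so the
   last condition says that the velocity of the projected curve does not vanish (regularity);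
   it does not depend on the choice of the lift. *)
definition L_curve :: "real set \<Rightarrow> (real \<Rightarrow> (complex ^ 3) set) \<Rightarrow> bool" where
  "L_curve I \<gamma> \<longleftrightarrow> \<gamma> ` I \<subseteq> sphere3 \<and>
     (\<exists>\<Gamma>. smooth_curve I \<Gamma> \<and>
       (\<forall>x\<in>I. \<Gamma> x \<in> null_cone \<and> proj (\<Gamma> x) = \<gamma> x \<and>
               herm (vec_deriv \<Gamma> x) (\<Gamma> x) = 0 \<and>
               (\<forall>c. vec_deriv \<Gamma> x \<noteq> c *s \<Gamma> x)))"

definition null_frame :: "complex ^ 3 \<Rightarrow> complex ^ 3 \<Rightarrow> complex ^ 3 \<Rightarrow> bool" where
  "null_frame e0 e1 e2 \<longleftrightarrow>
     herm e0 e0 = 0 \<and> herm e0 e1 = 0 \<and> herm e2 e1 = 0 \<and> herm e2 e2 = 0 \<and>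
     herm e2 e0 = \<i> \<and> herm e0 e2 = - \<i> \<and> herm e1 e1 = 1 \<and>
     det (vector [e0, e1, e2] :: complex ^ 3 ^ 3) = 1"

definition normalized_framing ::
  "real set \<Rightarrow> (real \<Rightarrow> (complex ^ 3) set) \<Rightarrow>
   (real \<Rightarrow> complex ^ 3) \<Rightarrow> (real \<Rightarrow> complex ^ 3) \<Rightarrow> (real \<Rightarrow> complex ^ 3) \<Rightarrow>
   (real \<Rightarrow> real) \<Rightarrow> (real \<Rightarrow> real) \<Rightarrow> bool" where
  "normalized_framing I \<gamma> \<Gamma> T N k l \<longleftrightarrow>
     smooth_curve I \<Gamma> \<and> smooth_curve I T \<and> smooth_curve I N \<and>
     (\<forall>x\<in>I. null_frame (\<Gamma> x) (T x) (N x) \<and> proj (\<Gamma> x) = \<gamma> x \<and>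
        vec_deriv \<Gamma> x = T x \<and>
        vec_deriv T x = \<i> *s N x + complex_of_real (k x) *s \<Gamma> x \<and>
        vec_deriv N x = complex_of_real (l x) *s \<Gamma> x - (\<i> * complex_of_real (k x)) *s T x)"

definition k_rhs ::
  "(real \<Rightarrow> real \<Rightarrow> real) \<Rightarrow> (real \<Rightarrow> real \<Rightarrow> real) \<Rightarrow> (real \<Rightarrow> real \<Rightarrow> real) \<Rightarrow> (real \<Rightarrow> real \<Rightarrow> real) \<Rightarrow>
   real \<Rightarrow> real \<Rightarrow> real" where
  "k_rhs k l a h x t =
     a x t * d_x k x t + 2 * k x t * d_x a x t + h x t * d_x l x t
     + 3/2 * l x t * d_x h x t - (d_x ^^ 3) a x t"

definition l_rhs ::
  "(real \<Rightarrow> real \<Rightarrow> real) \<Rightarrow> (real \<Rightarrow> real \<Rightarrow> real) \<Rightarrow> (real \<Rightarrow> real \<Rightarrow> real) \<Rightarrow> (real \<Rightarrow> real \<Rightarrow> real) \<Rightarrow>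
   real \<Rightarrow> real \<Rightarrow> real" where
  "l_rhs k l a h x t =
     a x t * d_x l x t + 3 * d_x a x t * l x t
     + 1/3 * h x t * (d_x ^^ 3) k x t + 3/2 * d_x h x t * (d_x ^^ 2) k x t
     + 5/2 * (d_x ^^ 2) h x t * d_x k x t
     - 8/3 * h x t * k x t * d_x k x t - 8/3 * d_x h x t * (k x t)\<^sup>2
     + 5/3 * (d_x ^^ 3) h x t * k x t - 1/6 * (d_x ^^ 5) h x t"

definition invariant_system_at ::
  "(real \<Rightarrow> real \<Rightarrow> real) \<Rightarrow> (real \<Rightarrow> real \<Rightarrow> real) \<Rightarrow> (real \<Rightarrow> real \<Rightarrow> real) \<Rightarrow> (real \<Rightarrow> real \<Rightarrow> real) \<Rightarrow>
   real \<Rightarrow> real \<Rightarrow> bool" where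
  "invariant_system_at k l a h x t \<longleftrightarrow>
     d_t k x t = k_rhs k l a h x t \<and> d_t l x t = l_rhs k l a h x t"

definition framing_flow_at ::
  "(real \<Rightarrow> real \<Rightarrow> complex ^ 3) \<Rightarrow> (real \<Rightarrow> real \<Rightarrow> complex ^ 3) \<Rightarrow> (real \<Rightarrow> real \<Rightarrow> complex ^ 3) \<Rightarrow>
   (real \<Rightarrow> real \<Rightarrow> real) \<Rightarrow> (real \<Rightarrow> real \<Rightarrow> real) \<Rightarrow> (real \<Rightarrow> real \<Rightarrow> real) \<Rightarrow>
   real \<Rightarrow> real \<Rightarrow> bool" where
  "framing_flow_at \<Gamma> T N k a h x t \<longleftrightarrow>
     d_t \<Gamma> x t =
       (- complex_of_real (d_x a x t)
          + 1/3 * \<i> * complex_of_real (k x t * h x t - 1/2 * (d_x ^^ 2) h x t)) *s \<Gamma> x t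
       + (complex_of_real (a x t) + 1/2 * \<i> * complex_of_real (d_x h x t)) *s T x t
       + complex_of_real (h x t) *s N x t"

(* U n and V n stand for the n-th x-derivatives of u and v. A differential polynomial is a
   real polynomial in these variables; the keys of the outer mapping are the monomials, written
   additively as exponent vectors, so that multiplication is polynomial multiplication. *)
datatype jet_var = U nat | V nat

type_synonym diff_poly = "(jet_var \<Rightarrow>\<^sub>0 nat) \<Rightarrow>\<^sub>0 real"

fun next_var :: "jet_var \<Rightarrow> jet_var" where
  "next_var (U n) = U (Suc n)"
| "next_var (V n) = V (Suc n)"

definition dconst :: "real \<Rightarrow> diff_poly" where
  "dconst c = Poly_Mapping.single 0 c"

definition dvar :: "jet_var \<Rightarrow> diff_poly" where
  "dvar y = Poly_Mapping.single (Poly_Mapping.single y 1) 1"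

definition const_term :: "diff_poly \<Rightarrow> real" where
  "const_term p = Poly_Mapping.lookup p 0"

(* Total x-derivative: the derivation sending each variable to the next one and killing constants.
   On a monomial m it sums, over the variables y of m, (exponent of y) * m * y' / y. *)
definition total_D :: "diff_poly \<Rightarrow> diff_poly" where
  "total_D p = (\<Sum>m\<in>Poly_Mapping.keys p. \<Sum>y\<in>Poly_Mapping.keys m.
      Poly_Mapping.single (m - Poly_Mapping.single y 1 + Poly_Mapping.single (next_var y) 1)
        (Poly_Mapping.lookup p m * of_nat (Poly_Mapping.lookup m y)))"

(* The antiderivative without constant term: unique by total_D_inv_eq below. Where f is not a total
   derivative the value is unspecified; by locality this does not occur along the hierarchy. *)
definition total_D_inv :: "diff_poly \<Rightarrow> diff_poly" where
  "total_D_inv f = (THE g. total_D g = f \<and> const_term g = 0)"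

definition jet :: "(real \<Rightarrow> real \<Rightarrow> real) \<Rightarrow> (real \<Rightarrow> real \<Rightarrow> real) \<Rightarrow> jet_var \<Rightarrow> real \<Rightarrow> real \<Rightarrow> real" where
  "jet u v y = (case y of U n \<Rightarrow> (d_x ^^ n) u | V n \<Rightarrow> (d_x ^^ n) v)"

(* The value p[u,v] at (x,t). *)
definition dp_eval ::
  "diff_poly \<Rightarrow> (real \<Rightarrow> real \<Rightarrow> real) \<Rightarrow> (real \<Rightarrow> real \<Rightarrow> real) \<Rightarrow> real \<Rightarrow> real \<Rightarrow> real" where
  "dp_eval p u v x t = (\<Sum>m\<in>Poly_Mapping.keys p.
      Poly_Mapping.lookup p m * (\<Prod>y\<in>Poly_Mapping.keys m. jet u v y x t ^ Poly_Mapping.lookup m y))"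

definition op_Q :: "diff_poly \<times> diff_poly \<Rightarrow> diff_poly \<times> diff_poly" where
  "op_Q = (\<lambda>(f, g). (total_D g, total_D f))"

definition op_Q_inv :: "diff_poly \<times> diff_poly \<Rightarrow> diff_poly \<times> diff_poly" where
  "op_Q_inv = (\<lambda>(f, g). (total_D_inv g, total_D_inv f))"

definition op_P :: "diff_poly \<times> diff_poly \<Rightarrow> diff_poly \<times> diff_poly" where
  "op_P = (\<lambda>(f, g).
    let D = total_D; u = dvar (U 0); u_x = dvar (U 1); u_xx = dvar (U 2);
        v = dvar (V 0); v_x = dvar (V 1)
    in ((D ^^ 3) f + 2 * u * D f + u_x * f
          + (3 * v * D g + 2 * v_x * g),
        (3 * v * D f + v_x * f)
          + (dconst (1/3) * (D ^^ 5) g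
             + dconst (5/3) * (u * (D ^^ 3) g + (D ^^ 3) (u * g))
             - (u_xx * D g + D (u_xx * g))
             + dconst (16/3) * u * D (u * g))))"

fun hierarchy_G :: "nat \<Rightarrow> diff_poly \<times> diff_poly" where
  "hierarchy_G 0 = (1, 0)"
| "hierarchy_G (Suc 0) = (0, dconst (1/2))"
| "hierarchy_G (Suc (Suc n)) = op_Q_inv (op_P (hierarchy_G n))"

definition hierarchy_F :: "nat \<Rightarrow> diff_poly \<times> diff_poly" where
  "hierarchy_F n = op_P (hierarchy_G n)"

definition boussinesq_flow_at ::
  "nat \<Rightarrow> (real \<Rightarrow> real \<Rightarrow> real) \<Rightarrow> (real \<Rightarrow> real \<Rightarrow> real) \<Rightarrow> real \<Rightarrow> real \<Rightarrow> bool" where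
  "boussinesq_flow_at n u v x t \<longleftrightarrow>
     d_t u x t = dp_eval (fst (hierarchy_F n)) u v x t \<and>
     d_t v x t = dp_eval (snd (hierarchy_F n)) u v x t"

fun var_order :: "jet_var \<Rightarrow> nat" where
  "var_order (U n) = n"
| "var_order (V n) = n"

lemma next_var_inj: "next_var y = next_var z \<Longrightarrow> y = z"
  by (cases y; cases z) auto

lemma var_order_next [simp]: "var_order (next_var y) = Suc (var_order y)"
  by (cases y) auto

lemma total_D_superset:
  assumes "finite A" "Poly_Mapping.keys p \<subseteq> A"
  shows "total_D p = (\<Sum>m\<in>A. \<Sum>y\<in>Poly_Mapping.keys m.
      Poly_Mapping.single (m - Poly_Mapping.single y 1 + Poly_Mapping.single (next_var y) 1)
        (Poly_Mapping.lookup p m * of_nat (Poly_Mapping.lookup m y)))"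
  unfolding total_D_def
  by (rule sum.mono_neutral_left) (use assms in \<open>auto simp: in_keys_iff\<close>)

lemma total_D_diff: "total_D (p - q) = total_D p - total_D q"
proof -
  let ?A = "Poly_Mapping.keys p \<union> Poly_Mapping.keys q"
  have "Poly_Mapping.keys (p - q) \<subseteq> ?A"
    by (auto simp: in_keys_iff lookup_minus)
  then show ?thesis
    by (simp add: total_D_superset[of ?A] sum_subtractf[symmetric] lookup_minus
        left_diff_distrib single_diff)
qed

lemma total_D_eq_0:
  assumes "total_D p = 0" "const_term p = 0"
  shows "p = 0"
proof (rule ccontr)
  assume "p \<noteq> 0"
  define Y where "Y = (\<Union>m\<in>Poly_Mapping.keys p. Poly_Mapping.keys m)"
  have finY: "finite Y" by (simp add: Y_def)
  obtain m0 where m0: "m0 \<in> Poly_Mapping.keys p"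
    using \<open>p \<noteq> 0\<close> by (metis keys_eq_empty ex_in_conv)
  then have "m0 \<noteq> 0" using assms(2) by (auto simp: const_term_def in_keys_iff)
  then have "Y \<noteq> {}" using m0 unfolding Y_def by (metis UN_I empty_iff ex_in_conv keys_eq_empty)
  then have "Max (var_order ` Y) \<in> var_order ` Y" using finY by simp
  then obtain y where y: "y \<in> Y" "var_order y = Max (var_order ` Y)" by auto
  then have ymax: "var_order z \<le> var_order y" if "z \<in> Y" for z using finY that by simp
  obtain m where m: "m \<in> Poly_Mapping.keys p" "y \<in> Poly_Mapping.keys m"
    using y(1) by (auto simp: Y_def)
  let ?s = "\<lambda>y. Poly_Mapping.single y (1::nat)"
  let ?c = "\<lambda>m z. Poly_Mapping.lookup p m * of_nat (Poly_Mapping.lookup m z)"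
  let ?m' = "\<lambda>m z. m - ?s z + ?s (next_var z)"
  have key: "n = m \<and> z = y"
    if n: "n \<in> Poly_Mapping.keys p" "z \<in> Poly_Mapping.keys n" and eq: "?m' n z = ?m' m y" for n z
  proof -
    have "z \<in> Y" using n by (auto simp: Y_def)
    have "next_var y \<notin> Y" using ymax by fastforce
    then have "next_var y \<notin> Poly_Mapping.keys n" using n by (auto simp: Y_def)
    then have "Poly_Mapping.lookup n (next_var y) = 0" by (simp add: in_keys_iff)
    moreover have "Poly_Mapping.lookup (?m' n z) (next_var y) > 0"
      unfolding eq by (simp add: lookup_add)
    ultimately have "next_var z = next_var y"
      by (auto simp: lookup_add lookup_minus lookup_single when_def split: if_splits)
    then have zy: "z = y" by (rule next_var_inj)
    have "n - ?s y = m - ?s y" using eq zy by simp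
    moreover have "n - ?s y + ?s y = n" "m - ?s y + ?s y = m"
      using n(2) m(2) zy
      by (auto intro!: poly_mapping_eqI simp: lookup_add lookup_minus lookup_single in_keys_iff when_def)
    ultimately show ?thesis using zy by metis
  qed
  have "Poly_Mapping.lookup (total_D p) (?m' m y) =
     (\<Sum>n\<in>Poly_Mapping.keys p. \<Sum>z\<in>Poly_Mapping.keys n. if n = m \<and> z = y then ?c m y else 0)"
    unfolding total_D_def lookup_sum
    by (intro sum.cong refl) (auto simp: lookup_single when_def dest: key)
  also have "\<dots> = (\<Sum>n\<in>Poly_Mapping.keys p. if n = m then ?c m y else 0)"
    using m by (intro sum.cong refl) (auto simp: sum.delta)
  also have "\<dots> = ?c m y" using m by (simp add: sum.delta)
  also have "\<dots> \<noteq> 0" using m by (simp add: in_keys_iff)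
  finally show False using assms(1) by simp
qed

lemma total_D_inv_eq:
  assumes "total_D g = f" "const_term g = 0"
  shows "total_D_inv f = g"
  unfolding total_D_inv_def
proof (rule the_equality)
  fix g' assume "total_D g' = f \<and> const_term g' = 0"
  then have "total_D (g' - g) = 0" "const_term (g' - g) = 0"
    using assms by (simp_all add: total_D_diff const_term_def lookup_minus)
  then have "g' - g = 0" by (rule total_D_eq_0)
  then show "g' = g" by simp
qed (use assms in simp)

lemma op_Q_inv_eq:
  assumes "op_Q (f, g) = w" "const_term f = 0" "const_term g = 0"
  shows "op_Q_inv w = (f, g)"
  using assms by (auto simp: op_Q_def op_Q_inv_def total_D_inv_eq)

lemma hierarchy_F_Suc_Suc: "hierarchy_F (Suc (Suc n)) = op_P (op_Q_inv (hierarchy_F n))"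
  by (simp add: hierarchy_F_def)

lemma total_D_monom [simp]:
  "total_D (Poly_Mapping.single (Poly_Mapping.single y (Suc 0)) c) =
   Poly_Mapping.single (Poly_Mapping.single (next_var y) (Suc 0)) c"
  by (cases "c = 0") (auto simp: total_D_def)

lemma total_D_dvar: "total_D (dvar y) = dvar (next_var y)"
  by (simp add: dvar_def)

lemma total_D_single_0 [simp]: "total_D (Poly_Mapping.single 0 c) = 0"
  by (cases "c = 0") (auto simp: total_D_def)

lemma total_D_0 [simp]: "total_D 0 = 0"
  by (simp add: total_D_def)

lemma total_D_1 [simp]: "total_D 1 = 0"
  by (simp add: total_D_def)

lemma hierarchy_F_0: "hierarchy_F 0 = (dvar (U 1), dvar (V 1))"
  by (simp add: hierarchy_F_def op_P_def Let_def numeral_eq_Suc)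

lemma hierarchy_F_1:
  "hierarchy_F 1 =
    (dvar (V 1), dconst (1/3) * dvar (U 3) + dconst (8/3) * dvar (U 0) * dvar (U 1))"
proof -
  have two: "2 = (Poly_Mapping.single 0 2 :: diff_poly)" by simp
  have half: "2 * q * Poly_Mapping.single 0 (1/2) = q" for q :: diff_poly
  proof -
    have "2 * Poly_Mapping.single 0 (1/2) = (1 :: diff_poly)"
      unfolding two mult_single by simp
    then show ?thesis by (metis mult.assoc mult.commute mult_1_right)
  qed
  show ?thesis
    unfolding hierarchy_F_def op_P_def Let_def
    by (simp add: numeral_eq_Suc dvar_def dconst_def mult_single half
        flip: single_add single_diff)
qed

lemma const_term_dvar [simp]: "const_term (dvar y) = 0"
proof -
  have "Poly_Mapping.single y (1::nat) \<noteq> 0"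
    by (metis lookup_single_eq lookup_zero one_neq_zero)
  then show ?thesis by (simp add: const_term_def dvar_def lookup_single)
qed

lemma hierarchy_G_2: "hierarchy_G 2 = (dvar (V 0), dvar (U 0))"
proof -
  have "hierarchy_G 2 = op_Q_inv (dvar (U 1), dvar (V 1))"
    using hierarchy_F_0 by (simp add: numeral_2_eq_2 hierarchy_F_def)
  also have "\<dots> = (dvar (V 0), dvar (U 0))"
    by (rule op_Q_inv_eq)
       (simp_all add: op_Q_def total_D_dvar)
  finally show ?thesis .
qed

end

theory Submission
  imports Defs
begin

text \<open>
  The geometric half is a compatibility computation: the evolution of \<open>T\<close> and \<open>N\<close> follows from that of
  \<open>\<Gamma>\<close> and the frame equations by exchanging \<open>x\<close>- and \<open>t\<close>-derivatives. Differentiating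
  \<open>\<langle>N, N\<rangle> = 0\<close> in \<open>t\<close> then forces the \<open>\<Gamma>\<close>-coefficient of \<open>N\<^sub>t\<close> to be real, which is the
  equation for \<open>k\<^sub>t\<close>; the equation for \<open>\<ell>\<^sub>t\<close> is the real part of the \<open>\<Gamma>\<close>-coefficient of
  \<open>N\<^sub>x\<^sub>t = N\<^sub>t\<^sub>x\<close>. The hierarchy half holds for any differential polynomials \<open>(f, g)\<close> in place of
  \<open>G\<^sub>n\<close>: evaluation turns the total derivative into \<open>d/dx\<close>, and the right-hand sides of the system are
  \<open>\<P>(f, g)\<close> evaluated at \<open>u = - k\<close>, \<open>v = \<ell>\<close>.
\<close>

section \<open>Smooth functions of two variables\<close>

text \<open>Clairaut's theorem. The second difference of \<open>f\<close> over a small square of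
  side \<open>d\<close> is, by the mean value theorem applied in the two possible orders,
  \<open>d * d\<close> times a value of \<open>fxt\<close> and also \<open>d * d\<close> times a
  value of \<open>ftx\<close>. Continuity at the corner carries the equality there.\<close>

lemma mixed_partials_eq_real:
  fixes f fx ft fxt ftx :: "real \<Rightarrow> real \<Rightarrow> real"
  assumes S: "open S" "(x0, t0) \<in> S"
    and fx: "\<And>x t. (x, t) \<in> S \<Longrightarrow> ((\<lambda>y. f y t) has_real_derivative fx x t) (at x)"
    and ft: "\<And>x t. (x, t) \<in> S \<Longrightarrow> ((\<lambda>s. f x s) has_real_derivative ft x t) (at t)"
    and fxt: "\<And>x t. (x, t) \<in> S \<Longrightarrow> ((\<lambda>s. fx x s) has_real_derivative fxt x t) (at t)"
    and ftx: "\<And>x t. (x, t) \<in> S \<Longrightarrow> ((\<lambda>y. ft y t) has_real_derivative ftx x t) (at x)"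
    and cont: "isCont (\<lambda>(x, t). fxt x t) (x0, t0)" "isCont (\<lambda>(x, t). ftx x t) (x0, t0)"
  shows "fxt x0 t0 = ftx x0 t0"
proof (rule ccontr)
  assume neq: "fxt x0 t0 \<noteq> ftx x0 t0"
  \<comment> \<open>Half the gap: one common value cannot lie within \<open>e\<close> of both
    limits.\<close>
  define e where "e = \<bar>fxt x0 t0 - ftx x0 t0\<bar> / 2"
  have "e > 0" using neq by (simp add: e_def)
  obtain r1 where r1: "r1 > 0" "\<And>p. dist p (x0, t0) < r1 \<Longrightarrow> dist (case p of (x, t) \<Rightarrow> fxt x t) (fxt x0 t0) < e"
    using cont(1) \<open>e > 0\<close> unfolding continuous_at_eps_delta by fastforce
  obtain r2 where r2: "r2 > 0" "\<And>p. dist p (x0, t0) < r2 \<Longrightarrow> dist (case p of (x, t) \<Rightarrow> ftx x t) (ftx x0 t0) < e"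
    using cont(2) \<open>e > 0\<close> unfolding continuous_at_eps_delta by fastforce
  obtain r3 where r3: "r3 > 0" "ball (x0, t0) r3 \<subseteq> S"
    using S open_contains_ball by blast
  \<comment> \<open>Points of the square are at distance at most \<open>2 * d\<close> from the
    corner, so a third of the smallest radius keeps the square inside all three balls.\<close>
  define d where "d = Min {r1, r2, r3} / 3"
  have d: "d > 0" "3 * d \<le> r1" "3 * d \<le> r2" "3 * d \<le> r3"
    using r1(1) r2(1) r3(1) by (auto simp: d_def)
  have near: "dist (x, t) (x0, t0) < 3 * d" if "x0 \<le> x" "x \<le> x0 + d" "t0 \<le> t" "t \<le> t0 + d" for x t
  proof -
    have "dist (x, t) (x0, t0) \<le> \<bar>x - x0\<bar> + \<bar>t - t0\<bar>"
      by (simp add: dist_Pair_Pair dist_real_def sqrt_sum_squares_le_sum_abs)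
    then show ?thesis using that d(1) by linarith
  qed
  then have inS: "(x, t) \<in> S" if "x0 \<le> x" "x \<le> x0 + d" "t0 \<le> t" "t \<le> t0 + d" for x t
    using r3(2) d(4) that by (force simp: dist_commute)
  have d': "x0 < x0 + d" "t0 < t0 + d" using d by auto
  obtain \<xi> where \<xi>: "x0 < \<xi>" "\<xi> < x0 + d"
    "f (x0 + d) (t0 + d) - f (x0 + d) t0 - (f x0 (t0 + d) - f x0 t0) = d * (fx \<xi> (t0 + d) - fx \<xi> t0)"
    using MVT2[of x0 "x0 + d" "\<lambda>y. f y (t0 + d) - f y t0" "\<lambda>y. fx y (t0 + d) - fx y t0"] d'
    by (force intro!: DERIV_diff fx inS)
  obtain \<eta> where \<eta>: "t0 < \<eta>" "\<eta> < t0 + d" "fx \<xi> (t0 + d) - fx \<xi> t0 = d * fxt \<xi> \<eta>"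
    using MVT2[of t0 "t0 + d" "\<lambda>s. fx \<xi> s" "\<lambda>s. fxt \<xi> s"] d' \<xi>
    by (force intro!: fxt inS)
  \<comment> \<open>The same second difference, now grouped with the t-increment outermost.\<close>
  obtain \<eta>' where \<eta>': "t0 < \<eta>'" "\<eta>' < t0 + d"
    "f (x0 + d) (t0 + d) - f x0 (t0 + d) - (f (x0 + d) t0 - f x0 t0) = d * (ft (x0 + d) \<eta>' - ft x0 \<eta>')"
    using MVT2[of t0 "t0 + d" "\<lambda>s. f (x0 + d) s - f x0 s" "\<lambda>s. ft (x0 + d) s - ft x0 s"] d'
    by (force intro!: DERIV_diff ft inS)
  obtain \<xi>' where \<xi>': "x0 < \<xi>'" "\<xi>' < x0 + d" "ft (x0 + d) \<eta>' - ft x0 \<eta>' = d * ftx \<xi>' \<eta>'"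
    using MVT2[of x0 "x0 + d" "\<lambda>y. ft y \<eta>'" "\<lambda>y. ftx y \<eta>'"] d' \<eta>'
    by (force intro!: ftx inS)
  have "d * (d * fxt \<xi> \<eta>) = d * (d * ftx \<xi>' \<eta>')"
    using \<xi>(3)[unfolded \<eta>(3)] \<eta>'(3)[unfolded \<xi>'(3)] by linarith
  then have "fxt \<xi> \<eta> = ftx \<xi>' \<eta>'" using d(1) by simp
  moreover have "\<bar>fxt \<xi> \<eta> - fxt x0 t0\<bar> < e"
    using r1(2)[of "(\<xi>, \<eta>)"] near[of \<xi> \<eta>] \<xi> \<eta> d by (auto simp: dist_real_def)
  moreover have "\<bar>ftx \<xi>' \<eta>' - ftx x0 t0\<bar> < e"
    using r2(2)[of "(\<xi>', \<eta>')"] near[of \<xi>' \<eta>'] \<xi>' \<eta>' d by (auto simp: dist_real_def)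
  moreover have "\<bar>fxt x0 t0 - ftx x0 t0\<bar> \<le> \<bar>fxt \<xi> \<eta> - fxt x0 t0\<bar> + \<bar>fxt \<xi> \<eta> - ftx x0 t0\<bar>"
    by linarith
  ultimately show False by (simp add: e_def)
qed

section \<open>Partial derivatives of jointly smooth functions\<close>

lemma smooth_on_d_x: "smooth_on S f \<Longrightarrow> smooth_on S (d_x f)"
  and smooth_on_d_t: "smooth_on S f \<Longrightarrow> smooth_on S (d_t f)"
  unfolding smooth_on_def by (metis C_n_on.simps(2))+

lemma smooth_on_d_x_funpow: "smooth_on S f \<Longrightarrow> smooth_on S ((d_x ^^ n) f)"
  by (induction n) (auto intro: smooth_on_d_x)

lemma smooth_on_differentiable:
  "smooth_on S f \<Longrightarrow> p \<in> S \<Longrightarrow> (\<lambda>(x, t). f x t) differentiable (at p)"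
  unfolding smooth_on_def by (metis C_n_on.simps(2))

lemma smooth_on_has_d_x:
  assumes "smooth_on S f" "(x, t) \<in> S"
  shows "((\<lambda>y. f y t) has_vector_derivative d_x f x t) (at x)"
proof -
  have "((\<lambda>y. (y, t)) has_derivative (\<lambda>z. (z, 0))) (at x)"
    by (auto intro!: derivative_eq_intros)
  then have "(\<lambda>y. (y, t)) differentiable (at x)" by (rule differentiableI)
  then have "(\<lambda>y. f y t) differentiable (at x)"
    using differentiable_chain_at[of "\<lambda>y. (y, t)" x "\<lambda>(x, t). f x t"]
      smooth_on_differentiable[OF assms] by (simp add: o_def)
  then show ?thesis by (simp add: d_x_def vector_derivative_works)
qed

lemma smooth_on_has_d_t:
  assumes "smooth_on S f" "(x, t) \<in> S"
  shows "((\<lambda>s. f x s) has_vector_derivative d_t f x t) (at t)"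
proof -
  have "((\<lambda>s. (x, s)) has_derivative (\<lambda>z. (0, z))) (at t)"
    by (auto intro!: derivative_eq_intros)
  then have "(\<lambda>s. (x, s)) differentiable (at t)" by (rule differentiableI)
  then have "(\<lambda>s. f x s) differentiable (at t)"
    using differentiable_chain_at[of "\<lambda>s. (x, s)" t "\<lambda>(x, t). f x t"]
      smooth_on_differentiable[OF assms] by (simp add: o_def)
  then show ?thesis by (simp add: d_t_def vector_derivative_works)
qed

text \<open>The mean value theorem is a statement about real values, so the real case is applied to
  each component \<open>f x t \<bullet> b\<close>.\<close>

lemma d_x_d_t_commute:
  fixes f :: "real \<Rightarrow> real \<Rightarrow> 'a::euclidean_space"
  assumes S: "open S" "(x, t) \<in> S" and f: "smooth_on S f"
  shows "d_x (d_t f) x t = d_t (d_x f) x t"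
proof (rule euclidean_eqI)
  fix b :: 'a assume "b \<in> Basis"
  note lin = bounded_linear.has_vector_derivative[OF bounded_linear_inner_left, of _ _ _ b]
  have cont: "isCont (\<lambda>(x, t). g x t \<bullet> b) (x, t)" if "smooth_on S g" for g :: "real \<Rightarrow> real \<Rightarrow> 'a"
    using differentiable_imp_continuous_within[OF smooth_on_differentiable[OF that S(2)]]
    by (auto simp: case_prod_unfold intro!: continuous_intros)
  have "d_t (d_x f) x t \<bullet> b = d_x (d_t f) x t \<bullet> b"
    by (rule mixed_partials_eq_real[OF S, where f = "\<lambda>x t. f x t \<bullet> b"
          and fx = "\<lambda>x t. d_x f x t \<bullet> b" and ft = "\<lambda>x t. d_t f x t \<bullet> b"
          and fxt = "\<lambda>x t. d_t (d_x f) x t \<bullet> b" and ftx = "\<lambda>x t. d_x (d_t f) x t \<bullet> b"])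
       (auto simp: has_real_derivative_iff_has_vector_derivative
          intro!: lin cont smooth_on_has_d_x[of S] smooth_on_has_d_t[of S] smooth_on_d_x smooth_on_d_t f)
  then show "d_x (d_t f) x t \<bullet> b = d_t (d_x f) x t \<bullet> b" by simp
qed

lemma d_x_eqI: "((\<lambda>y. f y t) has_vector_derivative D) (at x) \<Longrightarrow> d_x f x t = D"
  by (simp add: d_x_def vector_derivative_at)

lemma d_t_eqI: "((\<lambda>s. f x s) has_vector_derivative D) (at t) \<Longrightarrow> d_t f x t = D"
  by (simp add: d_t_def vector_derivative_at)

section \<open>Product rules for complex vectors and the Hermitian form\<close>

lemma has_vector_derivative_vector_scalar_mult:
  fixes F :: "real \<Rightarrow> complex ^ 'n"
  assumes "(c has_vector_derivative c') (at x)" "(F has_vector_derivative F') (at x)"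
  shows "((\<lambda>y. c y *s F y) has_vector_derivative (c x *s F' + c' *s F x)) (at x)"
proof -
  have "bounded_bilinear (\<lambda>(c::complex) (z::complex ^ 'n). c *s z)"
  proof
    show "\<exists>K. \<forall>(c::complex) (z::complex ^ 'n). norm (c *s z) \<le> norm c * norm z * K"
      by (intro exI[of _ 1])
         (simp add: norm_vec_def norm_mult L2_set_right_distrib)
  qed (simp_all add: vec_eq_iff algebra_simps)
  then show ?thesis by (rule bounded_bilinear.has_vector_derivative[OF _ assms])
qed

lemma herm_add_left: "herm (z + w) y = herm z y + herm w y"
  and herm_scale_left: "herm (c *s z) y = c * herm z y"
  and cnj_herm: "cnj (herm z w) = herm w z"
  by (simp_all add: herm_def algebra_simps)

text \<open>The two terms of the product rule are conjugate to each other by Hermitian symmetry.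
  Constancy of \<open>herm (F s) (F s)\<close> therefore gives one real equation.\<close>

lemma has_vector_derivative_herm_self:
  assumes "(F has_vector_derivative F') (at t)"
  shows "((\<lambda>s. herm (F s) (F s)) has_vector_derivative of_real (2 * Re (herm F' (F t)))) (at t)"
proof -
  note 1 = bounded_linear.has_vector_derivative[OF bounded_linear_vec_nth assms]
  note 2 = bounded_linear.has_vector_derivative[OF bounded_linear_cnj 1]
  show ?thesis unfolding herm_def
    by (rule derivative_eq_intros 1 2 refl)+
       (simp add: complex_eq_iff algebra_simps)
qed

section \<open>Evolution of the invariants\<close>

lemma has_vector_derivative_Complex:
  assumes "(f has_real_derivative f') F" "(g has_real_derivative g') F"
  shows "((\<lambda>x. Complex (f x) (g x)) has_vector_derivative Complex f' g') F"
proof -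
  have "((\<lambda>x. of_real (f x) + \<i> * of_real (g x)) has_vector_derivative (of_real f' + \<i> * of_real g')) F"
    by (rule derivative_eq_intros assms refl)+
  then show ?thesis by (simp add: Complex_eq)
qed

text \<open>All conditions hold on the whole open rectangle, so that each of them may be
  differentiated in either variable.\<close>

locale framed_evolution =
  fixes I J :: "real set" and \<Gamma> T N :: "real \<Rightarrow> real \<Rightarrow> complex ^ 3"
    and k l a h :: "real \<Rightarrow> real \<Rightarrow> real"
  assumes open_I: "open I" and open_J: "open J"
    and smooth: "smooth_on (I \<times> J) \<Gamma>" "smooth_on (I \<times> J) T" "smooth_on (I \<times> J) N"
      "smooth_on (I \<times> J) k" "smooth_on (I \<times> J) l" "smooth_on (I \<times> J) a" "smooth_on (I \<times> J) h"
    and null_frame: "\<And>x t. x \<in> I \<Longrightarrow> t \<in> J \<Longrightarrow> null_frame (\<Gamma> x t) (T x t) (N x t)"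
    and d_x_frame:
      "\<And>x t. x \<in> I \<Longrightarrow> t \<in> J \<Longrightarrow> d_x \<Gamma> x t = T x t"
      "\<And>x t. x \<in> I \<Longrightarrow> t \<in> J \<Longrightarrow> d_x T x t = \<i> *s N x t + complex_of_real (k x t) *s \<Gamma> x t"
      "\<And>x t. x \<in> I \<Longrightarrow> t \<in> J \<Longrightarrow>
         d_x N x t = complex_of_real (l x t) *s \<Gamma> x t - (\<i> * complex_of_real (k x t)) *s T x t"
    and flow: "\<And>x t. x \<in> I \<Longrightarrow> t \<in> J \<Longrightarrow> framing_flow_at \<Gamma> T N k a h x t"
begin

section \<open>Differentiation in the moving frame\<close>

lemma has_d_x_frame:
  assumes "x \<in> I" "t \<in> J"
  shows "((\<lambda>y. \<Gamma> y t) has_vector_derivative T x t) (at x)"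
    "((\<lambda>y. T y t) has_vector_derivative \<i> *s N x t + complex_of_real (k x t) *s \<Gamma> x t) (at x)"
    "((\<lambda>y. N y t) has_vector_derivative
       complex_of_real (l x t) *s \<Gamma> x t - (\<i> * complex_of_real (k x t)) *s T x t) (at x)"
  using smooth(1-3)[THEN smooth_on_has_d_x, of x t] d_x_frame[OF assms] assms by auto

lemma has_d_t:
  assumes "smooth_on (I \<times> J) f" "x \<in> I" "t \<in> J"
  shows "((\<lambda>s. f x s) has_vector_derivative d_t f x t) (at t)"
  using assms by (intro smooth_on_has_d_t) auto

lemma has_d_x_funpow:
  fixes f :: "real \<Rightarrow> real \<Rightarrow> real"
  assumes "smooth_on (I \<times> J) f" "x \<in> I" "t \<in> J"
  shows "((\<lambda>y. (d_x ^^ n) f y t) has_real_derivative (d_x ^^ Suc n) f x t) (at x)"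
  using smooth_on_has_d_x[OF smooth_on_d_x_funpow[OF assms(1)], of x t n] assms
  by (auto simp: has_real_derivative_iff_has_vector_derivative)

text \<open>The orders go as far as the system does: three for \<open>k\<close> and
  \<open>a\<close>, one for \<open>l\<close>, five for \<open>h\<close>. Orders zero and one are
  written without \<open>^^\<close>, to match the syntactic form met in the coefficients.\<close>

lemma has_d_x_coeffs:
  assumes "x \<in> I" "t \<in> J"
  shows
    "((\<lambda>y. k y t) has_real_derivative d_x k x t) (at x)"
    "((\<lambda>y. d_x k y t) has_real_derivative (d_x ^^ 2) k x t) (at x)"
    "((\<lambda>y. (d_x ^^ 2) k y t) has_real_derivative (d_x ^^ 3) k x t) (at x)"
    "((\<lambda>y. l y t) has_real_derivative d_x l x t) (at x)"
    "((\<lambda>y. a y t) has_real_derivative d_x a x t) (at x)"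
    "((\<lambda>y. d_x a y t) has_real_derivative (d_x ^^ 2) a x t) (at x)"
    "((\<lambda>y. (d_x ^^ 2) a y t) has_real_derivative (d_x ^^ 3) a x t) (at x)"
    "((\<lambda>y. h y t) has_real_derivative d_x h x t) (at x)"
    "((\<lambda>y. d_x h y t) has_real_derivative (d_x ^^ 2) h x t) (at x)"
    "((\<lambda>y. (d_x ^^ 2) h y t) has_real_derivative (d_x ^^ 3) h x t) (at x)"
    "((\<lambda>y. (d_x ^^ 3) h y t) has_real_derivative (d_x ^^ 4) h x t) (at x)"
    "((\<lambda>y. (d_x ^^ 4) h y t) has_real_derivative (d_x ^^ 5) h x t) (at x)"
  using has_d_x_funpow[OF smooth(4) assms, of 0] has_d_x_funpow[OF smooth(4) assms, of 1]
    has_d_x_funpow[OF smooth(4) assms, of 2] has_d_x_funpow[OF smooth(5) assms, of 0]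
    has_d_x_funpow[OF smooth(6) assms, of 0] has_d_x_funpow[OF smooth(6) assms, of 1]
    has_d_x_funpow[OF smooth(6) assms, of 2] has_d_x_funpow[OF smooth(7) assms, of 0]
    has_d_x_funpow[OF smooth(7) assms, of 1] has_d_x_funpow[OF smooth(7) assms, of 2]
    has_d_x_funpow[OF smooth(7) assms, of 3] has_d_x_funpow[OF smooth(7) assms, of 4]
  by (simp_all add: numeral_eq_Suc)

lemmas coeff_intros =
  derivative_eq_intros has_vector_derivative_vector_scalar_mult has_vector_derivative_Complex
  has_d_x_frame has_d_x_coeffs

abbreviation comb :: "complex \<Rightarrow> complex \<Rightarrow> complex \<Rightarrow> real \<Rightarrow> real \<Rightarrow> complex ^ 3" where
  "comb c0 c1 c2 x t \<equiv> c0 *s \<Gamma> x t + c1 *s T x t + c2 *s N x t"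

text \<open>The product rule with the frame equations substituted. The new coefficients are tied
  down by equational premises, so a caller may state them in simplified form and check them by real
  and imaginary parts.\<close>

lemma has_d_x_comb:
  assumes "x \<in> I" "t \<in> J"
    and "(c0 has_vector_derivative c0') (at x)" "(c1 has_vector_derivative c1') (at x)"
      "(c2 has_vector_derivative c2') (at x)"
    and "e0 = c0' + of_real (k x t) * c1 x + of_real (l x t) * c2 x"
      "e1 = c0 x + c1' - \<i> * of_real (k x t) * c2 x" "e2 = \<i> * c1 x + c2'"
  shows "((\<lambda>y. comb (c0 y) (c1 y) (c2 y) y t) has_vector_derivative comb e0 e1 e2 x t) (at x)"
  unfolding assms(6-8)
  by (rule derivative_eq_intros has_vector_derivative_vector_scalar_mult has_d_x_frame assms refl)+
     (simp add: vec_eq_iff algebra_simps)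

text \<open>The compatibility step: a formula for the t-derivative of \<open>F\<close> along the
  slice at time \<open>t\<close>, differentiated in x, is the t-derivative of \<open>d_x F\<close>
  by equality of mixed partials. The formula must hold on all of \<open>I\<close>, since it is
  differentiated there.\<close>

lemma d_t_d_x:
  fixes F :: "real \<Rightarrow> real \<Rightarrow> complex ^ 3"
  assumes F: "smooth_on (I \<times> J) F" and x: "x \<in> I" "t \<in> J"
    and dt: "\<And>y. y \<in> I \<Longrightarrow> d_t F y t = F' y"
    and dx: "(F' has_vector_derivative D) (at x)"
  shows "((\<lambda>s. d_x F x s) has_vector_derivative D) (at t)"
proof -
  have "((\<lambda>y. d_t F y t) has_vector_derivative D) (at x)"
    by (rule has_vector_derivative_transform_within_open[OF dx open_I x(1)]) (simp add: dt)
  then have "d_x (d_t F) x t = D" by (rule d_x_eqI)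
  then have "d_t (d_x F) x t = D"
    using d_x_d_t_commute[OF open_Times[OF open_I open_J] _ F, of x t] x by simp
  then show ?thesis
    using has_d_t[OF smooth_on_d_x[OF F] x] by simp
qed

text \<open>\<open>coef_AB\<close> is the \<open>B\<close>-component of \<open>A\<^sub>t\<close> in the frame, with \<open>G\<close> for \<open>\<Gamma>\<close>.
  The coefficient \<open>coef_NG\<close> is only the real part, the imaginary part being \<open>k\<^sub>t\<close> minus its asserted value.\<close>

definition "coef_GG x t = Complex (- d_x a x t) (1/3 * (k x t * h x t) - 1/6 * (d_x ^^ 2) h x t)"
definition "coef_GT x t = Complex (a x t) (1/2 * d_x h x t)"

lemma d_t_Gamma:
  assumes "x \<in> I" "t \<in> J"
  shows "d_t \<Gamma> x t = comb (coef_GG x t) (coef_GT x t) (of_real (h x t)) x t"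
  using flow[OF assms]
  by (simp add: framing_flow_at_def coef_GG_def coef_GT_def vec_eq_iff complex_eq_iff algebra_simps)

definition "coef_TG x t = Complex (- (d_x ^^ 2) a x t + a x t * k x t + h x t * l x t)
  (1/3 * (d_x k x t * h x t) + 5/6 * (k x t * d_x h x t) - 1/6 * (d_x ^^ 3) h x t)"
definition "coef_TT x t = Complex 0 (- 2/3 * (k x t * h x t) + 1/3 * (d_x ^^ 2) h x t)"
definition "coef_TN x t = Complex (1/2 * d_x h x t) (a x t)"

lemma d_t_T:
  assumes "x \<in> I" "t \<in> J"
  shows "d_t T x t = comb (coef_TG x t) (coef_TT x t) (coef_TN x t) x t"
proof -
  have "((\<lambda>y. comb (coef_GG y t) (coef_GT y t) (of_real (h y t)) y t) has_vector_derivative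
      comb (coef_TG x t) (coef_TT x t) (coef_TN x t) x t) (at x)"
    by (rule has_d_x_comb[OF assms], unfold coef_GG_def coef_GT_def, (rule coeff_intros assms refl)+)
       (simp_all add: coef_TG_def coef_TT_def coef_TN_def complex_eq_iff algebra_simps)
  from d_t_d_x[OF smooth(1) assms d_t_Gamma[OF _ assms(2)] this]
  have "((\<lambda>s. d_x \<Gamma> x s) has_vector_derivative comb (coef_TG x t) (coef_TT x t) (coef_TN x t) x t) (at t)" .
  \<comment> \<open>The frame equation \<open>d_x \<Gamma> = T\<close> holds at all times in the
    open set \<open>J\<close>, so it may be used under the t-derivative.\<close>
  then have "((\<lambda>s. T x s) has_vector_derivative comb (coef_TG x t) (coef_TT x t) (coef_TN x t) x t) (at t)"
    by (rule has_vector_derivative_transform_within_open[OF _ open_J assms(2)])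
       (simp add: d_x_frame assms(1))
  then show ?thesis by (rule d_t_eqI)
qed


definition "coef_NG x t =
   1/3 * ((d_x ^^ 2) k x t * h x t) + 7/6 * (d_x k x t * d_x h x t) + 4/3 * (k x t * (d_x ^^ 2) h x t)
    - 1/6 * (d_x ^^ 4) h x t - (k x t)\<^sup>2 * h x t + a x t * l x t"
definition "coef_NT x t = Complex
  (- 1/3 * (d_x k x t * h x t) - 5/6 * (k x t * d_x h x t) + 1/6 * (d_x ^^ 3) h x t)
  ((d_x ^^ 2) a x t - a x t * k x t - h x t * l x t)"
definition "coef_NN x t = Complex (d_x a x t) (1/3 * (k x t * h x t) - 1/6 * (d_x ^^ 2) h x t)"

text \<open>The frame equation for \<open>d_x T\<close> contains \<open>\<i> *s N\<close>. Its
  t-derivative is known from \<open>d_t_T\<close>, which can be solved for \<open>d_t N\<close>; the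
  unknown \<open>d_t k\<close> enters through the term \<open>k\<close> times
  \<open>\<Gamma>\<close>.\<close>

lemma d_t_N:
  assumes "x \<in> I" "t \<in> J"
  shows "d_t N x t = comb (Complex (coef_NG x t) (d_t k x t - k_rhs k l a h x t))
    (coef_NT x t) (coef_NN x t) x t"
proof -
  \<comment> \<open>These are arranged as \<open>\<i>\<close> times the expected coefficients of
    \<open>d_t N\<close>, with \<open>k_rhs\<close> for \<open>d_t k\<close>, plus \<open>k\<close>
    times those of \<open>d_t \<Gamma>\<close>. For the first,
    \<open>Complex (k_rhs k l a h x t) (coef_NG x t)\<close> is \<open>\<i>\<close> times
    \<open>Complex (coef_NG x t) (- k_rhs k l a h x t)\<close>.\<close>
  let ?e0 = "Complex (k_rhs k l a h x t) (coef_NG x t) + of_real (k x t) * coef_GG x t"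
  let ?e1 = "\<i> * coef_NT x t + of_real (k x t) * coef_GT x t"
  let ?e2 = "\<i> * coef_NN x t + of_real (k x t * h x t)"
  have "((\<lambda>y. comb (coef_TG y t) (coef_TT y t) (coef_TN y t) y t) has_vector_derivative
      comb ?e0 ?e1 ?e2 x t) (at x)"
    by (rule has_d_x_comb[OF assms], unfold coef_TG_def coef_TT_def coef_TN_def, (rule coeff_intros assms refl)+)
       (simp_all add: coef_NG_def coef_NT_def coef_NN_def coef_GG_def coef_GT_def k_rhs_def
          complex_eq_iff power2_eq_square algebra_simps)
  from d_t_d_x[OF smooth(2) assms d_t_T[OF _ assms(2)] this]
  have "((\<lambda>s. d_x T x s) has_vector_derivative comb ?e0 ?e1 ?e2 x t) (at t)" .
  then have 1: "((\<lambda>s. \<i> *s N x s + complex_of_real (k x s) *s \<Gamma> x s) has_vector_derivative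
     comb ?e0 ?e1 ?e2 x t) (at t)"
    by (rule has_vector_derivative_transform_within_open[OF _ open_J assms(2)])
       (simp add: d_x_frame assms(1))
  have "((\<lambda>s. \<i> *s N x s + complex_of_real (k x s) *s \<Gamma> x s) has_vector_derivative
     \<i> *s d_t N x t + (of_real (k x t) *s d_t \<Gamma> x t + of_real (d_t k x t) *s \<Gamma> x t)) (at t)"
    using has_d_t[OF smooth(4) assms]
    by (auto intro!: derivative_eq_intros has_vector_derivative_vector_scalar_mult has_d_t smooth assms
        simp: has_real_derivative_iff_has_vector_derivative)
  from vector_derivative_unique_at[OF this 1]
  have "\<i> *s d_t N x t = comb ?e0 ?e1 ?e2 x t -
      (of_real (k x t) *s d_t \<Gamma> x t + of_real (d_t k x t) *s \<Gamma> x t)"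
    by (simp add: eq_diff_eq)
  then have "(- \<i>) *s (\<i> *s d_t N x t) = (- \<i>) *s (comb ?e0 ?e1 ?e2 x t -
      (of_real (k x t) *s d_t \<Gamma> x t + of_real (d_t k x t) *s \<Gamma> x t))" by simp
  then show ?thesis
    by (simp add: d_t_Gamma[OF assms] vec_eq_iff complex_eq_iff algebra_simps)
qed

section \<open>The evolution equations from the null conditions and compatibility\<close>

text \<open>\<open>N\<close> is null and orthogonal to \<open>T\<close>, so pairing with
  \<open>N\<close> isolates the \<Gamma>-coefficient.\<close>

lemma herm_frame_N:
  assumes "x \<in> I" "t \<in> J"
  shows "herm (comb c0 c1 c2 x t) (N x t) = - \<i> * c0"
proof -
  have "herm (T x t) (N x t) = cnj (herm (N x t) (T x t))" by (simp add: cnj_herm)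
  then show ?thesis
    using null_frame[OF assms] by (simp add: null_frame_def herm_add_left herm_scale_left)
qed

lemma k_evolution:
  assumes "x \<in> I" "t \<in> J"
  shows "d_t k x t = k_rhs k l a h x t"
proof -
  have "((\<lambda>s. herm (N x s) (N x s)) has_vector_derivative
      of_real (2 * Re (herm (d_t N x t) (N x t)))) (at t)"
    by (intro has_vector_derivative_herm_self has_d_t smooth assms)
  moreover have "((\<lambda>s. herm (N x s) (N x s)) has_vector_derivative 0) (at t)"
    by (rule has_vector_derivative_transform_within_open[OF has_vector_derivative_const open_J assms(2)])
       (use null_frame assms(1) in \<open>simp add: null_frame_def\<close>)
  ultimately have "complex_of_real (2 * Re (herm (d_t N x t) (N x t))) = 0"
    by (rule vector_derivative_unique_at)
  \<comment> \<open>Multiplication by \<open>- \<i>\<close> turns the imaginary part of the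
    \<Gamma>-coefficient, \<open>d_t k - k_rhs\<close>, into the real part that vanishes.\<close>
  then show ?thesis by (simp add: d_t_N[OF assms] herm_frame_N[OF assms])
qed

lemma l_evolution:
  assumes "x \<in> I" "t \<in> J"
  shows "d_t l x t = l_rhs k l a h x t"
proof -
  \<comment> \<open>\<open>k_evolution\<close> on the whole slice makes the \<Gamma>-coefficient of
    \<open>d_t N\<close> the real function \<open>coef_NG\<close>, which can then be differentiated
    in x.\<close>
  have d_t_N': "d_t N y t = comb (of_real (coef_NG y t)) (coef_NT y t) (coef_NN y t) y t" if "y \<in> I" for y
    using d_t_N[OF that assms(2)] k_evolution[OF that assms(2)] by (simp add: complex_of_real_def)
  let ?p = "1/3 * ((d_x ^^ 3) k x t * h x t) + 3/2 * ((d_x ^^ 2) k x t * d_x h x t)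
    + 5/2 * (d_x k x t * (d_x ^^ 2) h x t) + 4/3 * (k x t * (d_x ^^ 3) h x t) - 1/6 * (d_x ^^ 5) h x t
    - 2 * (k x t * d_x k x t * h x t) - (k x t)\<^sup>2 * d_x h x t + d_x a x t * l x t + a x t * d_x l x t"
  have p: "((\<lambda>y. coef_NG y t) has_real_derivative ?p) (at x)"
    unfolding coef_NG_def
    by (rule coeff_intros assms refl)+ (simp add: power2_eq_square algebra_simps)
  \<comment> \<open>The derivatives of \<open>coef_NT\<close> and \<open>coef_NN\<close> enter only
    the T- and N-components of the result, so their existence suffices.\<close>
  obtain q where q: "((\<lambda>y. coef_NT y t) has_vector_derivative q) (at x)"
  proof -
    have "\<exists>D. ((\<lambda>y. coef_NT y t) has_vector_derivative D) (at x)"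
      unfolding coef_NT_def by (rule exI, (rule coeff_intros assms refl)+)
    then show ?thesis using that by blast
  qed
  obtain r where r: "((\<lambda>y. coef_NN y t) has_vector_derivative r) (at x)"
  proof -
    have "\<exists>D. ((\<lambda>y. coef_NN y t) has_vector_derivative D) (at x)"
      unfolding coef_NN_def by (rule exI, (rule coeff_intros assms refl)+)
    then show ?thesis using that by blast
  qed
  let ?e = "of_real ?p + of_real (k x t) * coef_NT x t + of_real (l x t) * coef_NN x t"
  obtain e1 e2 where "((\<lambda>y. comb (of_real (coef_NG y t)) (coef_NT y t) (coef_NN y t) y t)
      has_vector_derivative comb ?e e1 e2 x t) (at x)"
    using has_d_x_comb[OF assms has_vector_derivative_of_real[OF p] q r refl refl refl] by blast
  from d_t_d_x[OF smooth(3) assms d_t_N' this]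
  have "((\<lambda>s. d_x N x s) has_vector_derivative comb ?e e1 e2 x t) (at t)" .
  then have 1: "((\<lambda>s. complex_of_real (l x s) *s \<Gamma> x s - (\<i> * complex_of_real (k x s)) *s T x s)
      has_vector_derivative comb ?e e1 e2 x t) (at t)"
    by (rule has_vector_derivative_transform_within_open[OF _ open_J assms(2)])
       (simp add: d_x_frame assms(1))
  have "((\<lambda>s. complex_of_real (l x s) *s \<Gamma> x s - (\<i> * complex_of_real (k x s)) *s T x s)
      has_vector_derivative (of_real (l x t) *s d_t \<Gamma> x t + of_real (d_t l x t) *s \<Gamma> x t)
        - ((\<i> * of_real (k x t)) *s d_t T x t + (\<i> * of_real (d_t k x t)) *s T x t)) (at t)"
    using has_d_t[OF smooth(4) assms] has_d_t[OF smooth(5) assms]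
    by (auto intro!: derivative_eq_intros has_vector_derivative_vector_scalar_mult has_d_t smooth assms
        simp: has_real_derivative_iff_has_vector_derivative)
  from vector_derivative_unique_at[OF this 1]
  \<comment> \<open>The two expressions for the t-derivative of \<open>d_x N\<close> are paired with
    \<open>N\<close>, which leaves their \<Gamma>-coefficients.\<close>
  have "herm (comb (of_real (d_t l x t) + of_real (l x t) * coef_GG x t - \<i> * of_real (k x t) * coef_TG x t)
      (of_real (l x t) * coef_GT x t - \<i> * of_real (k x t) * coef_TT x t - \<i> * of_real (d_t k x t))
      (of_real (l x t * h x t) - \<i> * of_real (k x t) * coef_TN x t) x t) (N x t)
    = herm (comb ?e e1 e2 x t) (N x t)"
    by (intro arg_cong[where f = "\<lambda>z. herm z (N x t)"])
       (simp add: d_t_Gamma[OF assms] d_t_T[OF assms] vec_eq_iff algebra_simps)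
  then have "Re (of_real (d_t l x t) + of_real (l x t) * coef_GG x t - \<i> * of_real (k x t) * coef_TG x t) = Re ?e"
    unfolding herm_frame_N[OF assms] by simp
  then show ?thesis
    by (simp add: l_rhs_def coef_GG_def coef_TG_def coef_NT_def coef_NN_def power2_eq_square algebra_simps)
qed

end

text \<open>At fixed time \<open>vec_deriv\<close> of a slice is \<open>d_x\<close>, so the framings
  at the separate times supply the locale assumptions.\<close>

lemma invariant_system_of_framing_flow:
  assumes "open I" "open J"
    and "smooth_on (I \<times> J) \<Gamma>" "smooth_on (I \<times> J) T" "smooth_on (I \<times> J) N"
      "smooth_on (I \<times> J) k" "smooth_on (I \<times> J) l" "smooth_on (I \<times> J) a" "smooth_on (I \<times> J) h"
    and framing: "\<And>t. t \<in> J \<Longrightarrow>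
      normalized_framing I (\<lambda>x. \<gamma> x t) (\<lambda>x. \<Gamma> x t) (\<lambda>x. T x t) (\<lambda>x. N x t) (\<lambda>x. k x t) (\<lambda>x. l x t)"
    and flow: "\<And>x t. x \<in> I \<Longrightarrow> t \<in> J \<Longrightarrow> framing_flow_at \<Gamma> T N k a h x t"
    and "x \<in> I" "t \<in> J"
  shows "invariant_system_at k l a h x t"
proof -
  interpret framed_evolution I J \<Gamma> T N k l a h
    by unfold_locales
       (use assms(1-9) flow framing in \<open>auto simp: normalized_framing_def vec_deriv_def d_x_def\<close>)
  show ?thesis
    using k_evolution l_evolution assms by (simp add: invariant_system_at_def)
qed

section \<open>Evaluation of differential polynomials\<close>

text \<open>The jet values are abstracted to an arbitrary assignment \<open>w\<close>, so that
  evaluation can be studied as a ring homomorphism.\<close>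

definition monom_eval :: "('a \<Rightarrow> real) \<Rightarrow> ('a \<Rightarrow>\<^sub>0 nat) \<Rightarrow> real" where
  "monom_eval w m = (\<Prod>y\<in>Poly_Mapping.keys m. w y ^ Poly_Mapping.lookup m y)"

definition poly_eval :: "('a \<Rightarrow> real) \<Rightarrow> (('a \<Rightarrow>\<^sub>0 nat) \<Rightarrow>\<^sub>0 real) \<Rightarrow> real" where
  "poly_eval w p = (\<Sum>m\<in>Poly_Mapping.keys p. Poly_Mapping.lookup p m * monom_eval w m)"

lemma dp_eval_eq_poly_eval: "dp_eval p u v x t = poly_eval (\<lambda>y. jet u v y x t) p"
  by (simp add: dp_eval_def poly_eval_def monom_eval_def)

lemma monom_eval_superset:
  assumes "finite A" "Poly_Mapping.keys m \<subseteq> A"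
  shows "monom_eval w m = (\<Prod>y\<in>A. w y ^ Poly_Mapping.lookup m y)"
  unfolding monom_eval_def
  by (rule prod.mono_neutral_left) (use assms in \<open>auto simp: in_keys_iff\<close>)

text \<open>Cancellation can shrink the keys of a sum; a common finite superset allows termwise
  comparison.\<close>

lemma poly_eval_superset:
  assumes "finite A" "Poly_Mapping.keys p \<subseteq> A"
  shows "poly_eval w p = (\<Sum>m\<in>A. Poly_Mapping.lookup p m * monom_eval w m)"
  unfolding poly_eval_def
  by (rule sum.mono_neutral_left) (use assms in \<open>auto simp: in_keys_iff\<close>)

lemma monom_eval_add: "monom_eval w (m + n) = monom_eval w m * monom_eval w n"
  by (simp add: monom_eval_superset[of "Poly_Mapping.keys m \<union> Poly_Mapping.keys n"]
      Poly_Mapping.keys_add lookup_add power_add prod.distrib)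

lemma monom_eval_0 [simp]: "monom_eval w 0 = 1"
  by (simp add: monom_eval_def)

lemma monom_eval_single [simp]: "monom_eval w (Poly_Mapping.single y n) = w y ^ n"
  by (simp add: monom_eval_superset[of "{y}"] lookup_single)

lemma poly_eval_0 [simp]: "poly_eval w 0 = 0"
  by (simp add: poly_eval_def)

lemma poly_eval_single [simp]: "poly_eval w (Poly_Mapping.single m c) = c * monom_eval w m"
  by (simp add: poly_eval_superset[of "{m}"] lookup_single)

lemma poly_eval_add: "poly_eval w (p + q) = poly_eval w p + poly_eval w q"
  by (simp add: poly_eval_superset[of "Poly_Mapping.keys p \<union> Poly_Mapping.keys q"]
      Poly_Mapping.keys_add lookup_add algebra_simps sum.distrib)

lemma poly_eval_diff: "poly_eval w (p - q) = poly_eval w p - poly_eval w q"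
  using poly_eval_add[of w "p - q" q] by simp

lemma poly_eval_sum: "poly_eval w (\<Sum>i\<in>A. f i) = (\<Sum>i\<in>A. poly_eval w (f i))"
  by (induction A rule: infinite_finite_induct) (auto simp: poly_eval_add)

lemma poly_mapping_sum_single:
  "p = (\<Sum>m\<in>Poly_Mapping.keys p. Poly_Mapping.single m (Poly_Mapping.lookup p m))"
  by (rule poly_mapping_eqI)
     (simp add: lookup_sum lookup_single when_def sum.delta in_keys_iff)

text \<open>Identities additive in \<open>p\<close> reduce to monomials. The empty sum is the
  monomial with coefficient 0.\<close>

lemma poly_mapping_single_add_induct [case_names single add]:
  fixes p :: "'a \<Rightarrow>\<^sub>0 'b::comm_monoid_add"
  assumes single: "\<And>m c. P (Poly_Mapping.single m c)" and add: "\<And>p q. P p \<Longrightarrow> P q \<Longrightarrow> P (p + q)"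
  shows "P p"
proof -
  have "P (\<Sum>m\<in>A. Poly_Mapping.single m (Poly_Mapping.lookup p m))" if "finite A" for A
    using that
    by (induction A rule: finite_induct) (auto intro: add single simp: single[of _ 0, simplified])
  then show ?thesis by (subst poly_mapping_sum_single) simp
qed

lemma poly_eval_mult: "poly_eval w (p * q) = poly_eval w p * poly_eval w q"
proof (induction p rule: poly_mapping_single_add_induct)
  case (single m c)
  show ?case
    by (induction q rule: poly_mapping_single_add_induct)
       (simp_all add: mult_single monom_eval_add poly_eval_add distrib_left)
qed (simp add: distrib_right poly_eval_add)

lemma poly_eval_numeral [simp]: "poly_eval w (numeral n) = numeral n"
  by (simp flip: single_numeral)

lemma poly_eval_dconst [simp]: "poly_eval w (dconst c) = c"
  by (simp add: dconst_def)

lemma poly_eval_dvar [simp]: "poly_eval w (dvar y) = w y"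
  by (simp add: dvar_def)

section \<open>The total derivative as a derivation\<close>

lemma total_D_add: "total_D (p + q) = total_D p + total_D q"
  using total_D_diff[of "p + q" q] by simp

lemma total_D_single:
  assumes "finite A" "Poly_Mapping.keys m \<subseteq> A"
  shows "total_D (Poly_Mapping.single m c) = (\<Sum>y\<in>A.
    Poly_Mapping.single (m - Poly_Mapping.single y 1 + Poly_Mapping.single (next_var y) 1)
      (c * of_nat (Poly_Mapping.lookup m y)))"
proof -
  have "total_D (Poly_Mapping.single m c) = (\<Sum>y\<in>Poly_Mapping.keys m.
    Poly_Mapping.single (m - Poly_Mapping.single y 1 + Poly_Mapping.single (next_var y) 1)
      (c * of_nat (Poly_Mapping.lookup m y)))"
    by (subst total_D_superset[of "{m}"]) auto
  also have "\<dots> = (\<Sum>y\<in>A.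
    Poly_Mapping.single (m - Poly_Mapping.single y 1 + Poly_Mapping.single (next_var y) 1)
      (c * of_nat (Poly_Mapping.lookup m y)))"
    by (rule sum.mono_neutral_left) (use assms in \<open>auto simp: in_keys_iff\<close>)
  finally show ?thesis .
qed

text \<open>One summand of the Leibniz rule. Subtraction of exponents is truncated, so the shift is
  faithful only if \<open>y\<close> occurs in \<open>m\<close>; otherwise the factor
  \<open>Poly_Mapping.lookup m y\<close> kills both sides.\<close>

lemma single_shift_mult:
  "Poly_Mapping.single (m + n - Poly_Mapping.single y 1 + z) (c * d * of_nat (Poly_Mapping.lookup m y)) =
   Poly_Mapping.single (m - Poly_Mapping.single y (1::nat) + z) (c * of_nat (Poly_Mapping.lookup m y)) *
   Poly_Mapping.single n (d::real)"
proof (cases "Poly_Mapping.lookup m y = 0")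
  case False
  then have "m + n - Poly_Mapping.single y 1 = m - Poly_Mapping.single y 1 + n"
    by (intro poly_mapping_eqI) (auto simp: lookup_add lookup_minus lookup_single when_def)
  then show ?thesis by (simp add: mult_single ac_simps)
qed simp

text \<open>On monomials, summing over the variables of both factors, the exponent of
  \<open>y\<close> in \<open>m + n\<close> splits into its exponents in \<open>m\<close> and in
  \<open>n\<close>.\<close>

lemma total_D_mult: "total_D (p * q) = total_D p * q + p * total_D q"
proof (induction p rule: poly_mapping_single_add_induct)
  case (single m c)
  show ?case
  proof (induction q rule: poly_mapping_single_add_induct)
    case (single n d)
    let ?A = "Poly_Mapping.keys m \<union> Poly_Mapping.keys n"
    show ?case
      using single_shift_mult[of m n _ _ c d] single_shift_mult[of n m _ _ d c]
      by (simp add: mult_single total_D_single[of ?A] Poly_Mapping.keys_add lookup_add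
          distrib_left single_add sum.distrib sum_distrib_right sum_distrib_left ac_simps)
  qed (simp add: total_D_add distrib_left algebra_simps)
qed (simp add: total_D_add algebra_simps)

lemma total_D_dconst [simp]: "total_D (dconst c) = 0"
  by (simp add: dconst_def)

lemma total_D_numeral [simp]: "total_D (numeral n) = 0"
  by (simp flip: single_numeral)

text \<open>The chain rule: along an assignment that behaves like a jet, evaluation intertwines d/dx
  with \<open>total_D\<close>.\<close>

lemma has_derivative_poly_eval:
  assumes "\<And>y. ((\<lambda>s. w s y) has_real_derivative w x (next_var y)) (at x)"
  shows "((\<lambda>s. poly_eval (w s) p) has_real_derivative poly_eval (w x) (total_D p)) (at x)"
proof (induction p rule: poly_mapping_single_add_induct)
  case (single m c)
  have "((\<lambda>s. monom_eval (w s) m) has_real_derivative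
      (\<Sum>y\<in>Poly_Mapping.keys m. of_nat (Poly_Mapping.lookup m y) *
        monom_eval (w x) (m - Poly_Mapping.single y 1 + Poly_Mapping.single (next_var y) 1))) (at x)"
    (is "(_ has_real_derivative ?D) _")
  proof -
    have "((\<lambda>s. monom_eval (w s) m) has_real_derivative
      (\<Sum>y\<in>Poly_Mapping.keys m. (of_nat (Poly_Mapping.lookup m y) *
         (w x (next_var y) * w x y ^ (Poly_Mapping.lookup m y - Suc 0))) *
         (\<Prod>z\<in>Poly_Mapping.keys m - {y}. w x z ^ Poly_Mapping.lookup m z))) (at x)"
      unfolding monom_eval_def by (intro has_field_derivative_prod DERIV_power assms)
    also have "(\<Sum>y\<in>Poly_Mapping.keys m. (of_nat (Poly_Mapping.lookup m y) *
         (w x (next_var y) * w x y ^ (Poly_Mapping.lookup m y - Suc 0))) *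
         (\<Prod>z\<in>Poly_Mapping.keys m - {y}. w x z ^ Poly_Mapping.lookup m z)) = ?D"
    proof (rule sum.cong[OF refl])
      fix y assume y: "y \<in> Poly_Mapping.keys m"
      let ?m = "m - Poly_Mapping.single y 1"
      \<comment> \<open>The product stays over the keys of \<open>m\<close>, because
        \<open>y\<close> disappears from \<open>?m\<close> when its exponent was 1; its factor is
        then 1.\<close>
      have "monom_eval (w x) ?m = (\<Prod>z\<in>Poly_Mapping.keys m. w x z ^ Poly_Mapping.lookup ?m z)"
        by (rule monom_eval_superset) (auto simp: in_keys_iff lookup_minus)
      also have "\<dots> = w x y ^ (Poly_Mapping.lookup m y - Suc 0) *
          (\<Prod>z\<in>Poly_Mapping.keys m - {y}. w x z ^ Poly_Mapping.lookup ?m z)"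
        by (subst prod.remove[OF _ y]) (auto simp: lookup_minus)
      also have "(\<Prod>z\<in>Poly_Mapping.keys m - {y}. w x z ^ Poly_Mapping.lookup ?m z) =
          (\<Prod>z\<in>Poly_Mapping.keys m - {y}. w x z ^ Poly_Mapping.lookup m z)"
        by (intro prod.cong refl) (auto simp: lookup_minus lookup_single)
      finally show "(of_nat (Poly_Mapping.lookup m y) *
         (w x (next_var y) * w x y ^ (Poly_Mapping.lookup m y - Suc 0))) *
         (\<Prod>z\<in>Poly_Mapping.keys m - {y}. w x z ^ Poly_Mapping.lookup m z) =
        of_nat (Poly_Mapping.lookup m y) *
        monom_eval (w x) (m - Poly_Mapping.single y 1 + Poly_Mapping.single (next_var y) 1)"
        by (simp add: monom_eval_add)
    qed
    finally show ?thesis .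
  qed
  from DERIV_cmult[OF this, of c] show ?case
    by (simp add: total_D_single[OF finite_keys order_refl] poly_eval_sum sum_distrib_left ac_simps)
next
  case (add p q)
  then show ?case by (simp add: total_D_add poly_eval_add DERIV_add)
qed

section \<open>Comparison of the system with the hierarchy\<close>

lemma d_x_funpow_minus:
  assumes I: "open I" and k: "smooth_on (I \<times> J) k" and x: "x \<in> I" "t \<in> J"
  shows "(d_x ^^ n) (\<lambda>x t. - k x t) x t = - (d_x ^^ n) k x t"
  using x(1)
proof (induction n arbitrary: x)
  case (Suc n)
  have "((\<lambda>y. - (d_x ^^ n) k y t) has_vector_derivative - d_x ((d_x ^^ n) k) x t) (at x)"
    using smooth_on_has_d_x[OF smooth_on_d_x_funpow[OF k], of x t n] Suc.prems x(2)
    by (intro has_vector_derivative_minus) auto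
  then have "((\<lambda>y. (d_x ^^ n) (\<lambda>x t. - k x t) y t) has_vector_derivative - d_x ((d_x ^^ n) k) x t) (at x)"
    by (rule has_vector_derivative_transform_within_open[OF _ I Suc.prems]) (simp add: Suc.IH)
  then show ?case by (simp add: d_x_eqI)
qed simp

text \<open>Each further derivative depends on values near \<open>x\<close>, so the induction
  carries the identity on the whole open set \<open>I\<close>.\<close>

lemma d_x_funpow_dp_eval:
  assumes I: "open I"
    and jet: "\<And>x y. x \<in> I \<Longrightarrow>
      ((\<lambda>s. jet u v y s t) has_real_derivative jet u v (next_var y) x t) (at x)"
    and f: "\<And>x. x \<in> I \<Longrightarrow> f x t = dp_eval p u v x t" and x: "x \<in> I"
  shows "(d_x ^^ n) f x t = dp_eval ((total_D ^^ n) p) u v x t"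
  using x
proof (induction n arbitrary: x)
  case (Suc n)
  have "((\<lambda>y. dp_eval ((total_D ^^ n) p) u v y t) has_vector_derivative
      dp_eval ((total_D ^^ Suc n) p) u v x t) (at x)"
    using has_derivative_poly_eval[of "\<lambda>s y. jet u v y s t", OF jet[OF Suc.prems]]
    by (simp add: dp_eval_eq_poly_eval has_real_derivative_iff_has_vector_derivative)
  then have "((\<lambda>y. (d_x ^^ n) f y t) has_vector_derivative dp_eval ((total_D ^^ Suc n) p) u v x t) (at x)"
    by (rule has_vector_derivative_transform_within_open[OF _ I Suc.prems]) (simp add: Suc.IH)
  then show ?case by (simp add: d_x_eqI)
qed (simp add: f)

text \<open>Once the derivatives of \<open>a\<close> and \<open>h\<close> are expressed through
  \<open>total_D\<close>, both sides are the same polynomial in the jets. The sign in the first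
  equation comes from \<open>u = - k\<close>.\<close>

lemma rhs_eq_op_P:
  assumes I: "open I" and smooth: "smooth_on (I \<times> J) k" "smooth_on (I \<times> J) l"
    and a: "\<And>x. x \<in> I \<Longrightarrow> a x t = dp_eval f (\<lambda>x t. - k x t) l x t"
    and h: "\<And>x. x \<in> I \<Longrightarrow> - 1/2 * h x t = dp_eval g (\<lambda>x t. - k x t) l x t"
    and x: "x \<in> I" "t \<in> J"
  shows "- k_rhs k l a h x t = dp_eval (fst (op_P (f, g))) (\<lambda>x t. - k x t) l x t"
    and "l_rhs k l a h x t = dp_eval (snd (op_P (f, g))) (\<lambda>x t. - k x t) l x t"
proof -
  let ?u = "\<lambda>x t. - k x t"
  have jet: "((\<lambda>s. jet ?u l y s t) has_real_derivative jet ?u l (next_var y) x t) (at x)" if "x \<in> I" for x y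
  proof (cases y)
    case (U n)
    have "((\<lambda>y. - (d_x ^^ n) k y t) has_vector_derivative - (d_x ^^ Suc n) k x t) (at x)"
      using smooth_on_has_d_x[OF smooth_on_d_x_funpow[OF smooth(1)], of x t n] that x(2)
      by (intro has_vector_derivative_minus) auto
    then have "((\<lambda>y. (d_x ^^ n) ?u y t) has_vector_derivative - (d_x ^^ Suc n) k x t) (at x)"
      by (rule has_vector_derivative_transform_within_open[OF _ I that])
         (simp add: d_x_funpow_minus[OF I smooth(1) _ x(2)])
    then show ?thesis
      unfolding U next_var.simps jet_def jet_var.case d_x_funpow_minus[OF I smooth(1) that x(2)]
      by (simp only: has_real_derivative_iff_has_vector_derivative)
  next
    case (V n)
    then show ?thesis
      using smooth_on_has_d_x[OF smooth_on_d_x_funpow[OF smooth(2)], of x t n] that x(2)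
      by (simp add: jet_def has_real_derivative_iff_has_vector_derivative)
  qed
  note evals = dp_eval_eq_poly_eval poly_eval_mult poly_eval_add poly_eval_diff
  have D_cmult: "(total_D ^^ n) (dconst c * g) = dconst c * (total_D ^^ n) g" for c n
    by (induction n) (simp_all add: total_D_mult)
  \<comment> \<open>Inverting \<open>- 1/2 * h = g\<close> makes \<open>h\<close> itself the
    evaluation of a differential polynomial; \<open>D_cmult\<close> then moves the factor out of the
    iterated derivatives.\<close>
  have h': "h x t = dp_eval (dconst (- 2) * g) ?u l x t" if "x \<in> I" for x
    using h[OF that] by (simp add: evals)
  let ?e = "poly_eval (\<lambda>y. jet ?u l y x t)"
  have da: "(d_x ^^ n) a x t = ?e ((total_D ^^ n) f)" for n
    using d_x_funpow_dp_eval[where f = a, OF I jet a x(1)] by (simp only: evals)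
  have dh: "(d_x ^^ n) h x t = - 2 * ?e ((total_D ^^ n) g)" for n
    using d_x_funpow_dp_eval[where f = h, OF I jet h' x(1)]
    by (simp only: evals D_cmult poly_eval_dconst)
  note d = da dh da[of 0, simplified] da[of "Suc 0", simplified] dh[of 0, simplified] dh[of "Suc 0", simplified]
  have k_jet: "jet ?u l (U n) x t = - (d_x ^^ n) k x t" for n
    by (simp add: jet_def d_x_funpow_minus[OF I smooth(1) x])
  have l_jet: "jet ?u l (V n) x t = (d_x ^^ n) l x t" for n
    by (simp add: jet_def)
  show "- k_rhs k l a h x t = dp_eval (fst (op_P (f, g))) ?u l x t"
    unfolding k_rhs_def d op_P_def
    by (simp add: evals k_jet l_jet Let_def algebra_simps)
  \<comment> \<open>Unlike the first row, this row of \<P> differentiates the products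
    \<open>u * g\<close> and \<open>u_xx * g\<close>, hence the expansion by the Leibniz
    rule.\<close>
  show "l_rhs k l a h x t = dp_eval (snd (op_P (f, g))) ?u l x t"
    unfolding l_rhs_def d op_P_def
    by (simp add: evals k_jet l_jet Let_def total_D_mult total_D_add total_D_dvar numeral_eq_Suc
        power2_eq_square field_simps)
qed

text \<open>\<open>hierarchy_F n\<close> is \<open>op_P (hierarchy_G n)\<close> by definition, so
  the single identity above serves every \<open>n\<close>. The equivalence then follows because the
  t-derivative of \<open>- k\<close> is \<open>- d_t k\<close>.\<close>

lemma invariant_system_iff_flow:
  assumes I: "open I" and smooth: "smooth_on (I \<times> J) k" "smooth_on (I \<times> J) l"
    and a: "\<And>x. x \<in> I \<Longrightarrow> a x t = dp_eval (fst (hierarchy_G n)) (\<lambda>x t. - k x t) l x t"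
    and h: "\<And>x. x \<in> I \<Longrightarrow> - 1/2 * h x t = dp_eval (snd (hierarchy_G n)) (\<lambda>x t. - k x t) l x t"
    and x: "x \<in> I" "t \<in> J"
  shows "- k_rhs k l a h x t = dp_eval (fst (hierarchy_F n)) (\<lambda>x t. - k x t) l x t"
    and "l_rhs k l a h x t = dp_eval (snd (hierarchy_F n)) (\<lambda>x t. - k x t) l x t"
    and "invariant_system_at k l a h x t \<longleftrightarrow> boussinesq_flow_at n (\<lambda>x t. - k x t) l x t"
proof -
  have "((\<lambda>s. - k x s) has_vector_derivative - d_t k x t) (at t)"
    using smooth_on_has_d_t[OF smooth(1), of x t] x by (intro has_vector_derivative_minus) auto
  then have "d_t (\<lambda>x t. - k x t) x t = - d_t k x t" by (rule d_t_eqI)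
  moreover have rhs: "- k_rhs k l a h x t = dp_eval (fst (hierarchy_F n)) (\<lambda>x t. - k x t) l x t"
    "l_rhs k l a h x t = dp_eval (snd (hierarchy_F n)) (\<lambda>x t. - k x t) l x t"
    using rhs_eq_op_P[where f = "fst (hierarchy_G n)" and g = "snd (hierarchy_G n)", OF I smooth _ _ x] a h
    by (simp_all add: hierarchy_F_def)
  ultimately show "invariant_system_at k l a h x t \<longleftrightarrow> boussinesq_flow_at n (\<lambda>x t. - k x t) l x t"
    unfolding invariant_system_at_def boussinesq_flow_at_def rhs[symmetric] by simp
  show "- k_rhs k l a h x t = dp_eval (fst (hierarchy_F n)) (\<lambda>x t. - k x t) l x t"
    and "l_rhs k l a h x t = dp_eval (snd (hierarchy_F n)) (\<lambda>x t. - k x t) l x t"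
    by (fact rhs)+
qed

theorem theorem5:
  fixes I J :: "real set"
  assumes "open I" "is_interval I" "open J" "is_interval J"
  shows
    "(\<forall>\<gamma> \<Gamma> T N k l a h.
        smooth_on (I \<times> J) \<Gamma> \<and> smooth_on (I \<times> J) T \<and> smooth_on (I \<times> J) N \<and>
        smooth_on (I \<times> J) k \<and> smooth_on (I \<times> J) l \<and> smooth_on (I \<times> J) a \<and> smooth_on (I \<times> J) h \<and>
        (\<forall>t\<in>J. L_curve I (\<lambda>x. \<gamma> x t) \<and>
               normalized_framing I (\<lambda>x. \<gamma> x t) (\<lambda>x. \<Gamma> x t) (\<lambda>x. T x t) (\<lambda>x. N x t)
                 (\<lambda>x. k x t) (\<lambda>x. l x t)) \<and>
        (\<forall>x\<in>I. \<forall>t\<in>J. framing_flow_at \<Gamma> T N k a h x t)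
        \<longrightarrow> (\<forall>x\<in>I. \<forall>t\<in>J. invariant_system_at k l a h x t))
     \<and>
     (\<forall>(n::nat) (k :: real \<Rightarrow> real \<Rightarrow> real) l u v a h.
        smooth_on (I \<times> J) k \<and> smooth_on (I \<times> J) l \<and>
        u = (\<lambda>x t. - k x t) \<and> v = l \<and>
        (\<forall>x\<in>I. \<forall>t\<in>J. a x t = dp_eval (fst (hierarchy_G n)) u v x t \<and>
                        - 1/2 * h x t = dp_eval (snd (hierarchy_G n)) u v x t)
        \<longrightarrow> (\<forall>x\<in>I. \<forall>t\<in>J.
               - k_rhs k l a h x t = dp_eval (fst (hierarchy_F n)) u v x t \<and>
               l_rhs k l a h x t = dp_eval (snd (hierarchy_F n)) u v x t \<and>
               (invariant_system_at k l a h x t \<longleftrightarrow> boussinesq_flow_at n u v x t)))"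
proof (intro conjI allI impI ballI; (elim conjE)?)
  fix \<gamma> \<Gamma> T N k l a h x t
  assume "smooth_on (I \<times> J) \<Gamma>" "smooth_on (I \<times> J) T" "smooth_on (I \<times> J) N"
    "smooth_on (I \<times> J) k" "smooth_on (I \<times> J) l" "smooth_on (I \<times> J) a" "smooth_on (I \<times> J) h"
    and "\<forall>t\<in>J. L_curve I (\<lambda>x. \<gamma> x t) \<and>
      normalized_framing I (\<lambda>x. \<gamma> x t) (\<lambda>x. \<Gamma> x t) (\<lambda>x. T x t) (\<lambda>x. N x t) (\<lambda>x. k x t) (\<lambda>x. l x t)"
    and "\<forall>x\<in>I. \<forall>t\<in>J. framing_flow_at \<Gamma> T N k a h x t" and "x \<in> I" "t \<in> J"
  then show "invariant_system_at k l a h x t"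
    by (intro invariant_system_of_framing_flow[OF assms(1) assms(3), where \<gamma> = \<gamma> and \<Gamma> = \<Gamma> and T = T and N = N])
       auto
next
  fix n :: nat and k l u v a h x t
  assume sm: "smooth_on (I \<times> J) k" "smooth_on (I \<times> J) l" and uv: "u = (\<lambda>x t. - k x t)" "v = l"
    and G: "\<forall>x\<in>I. \<forall>t\<in>J. a x t = dp_eval (fst (hierarchy_G n)) u v x t \<and>
      - 1/2 * h x t = dp_eval (snd (hierarchy_G n)) u v x t"
    and x: "x \<in> I" "t \<in> J"
  note eqs = invariant_system_iff_flow[OF assms(1) sm _ _ x, of a n h, folded uv]
  show "- k_rhs k l a h x t = dp_eval (fst (hierarchy_F n)) u v x t"
    "l_rhs k l a h x t = dp_eval (snd (hierarchy_F n)) u v x t"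
    "invariant_system_at k l a h x t = boussinesq_flow_at n u v x t"
    using eqs G x(2) by (simp_all add: uv)
qed

end
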